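(* Let $n, m, k$ be non-negative integers with $0\le k\le m$. Then there exists a unique matrix $\tilde{\mathbf H}_{n,k}$ of size $(n+1)\times(n+m+1)$ such that $$\theta_{k,m}(x)\,\mathbf\Theta_n(x)=\tilde{\mathbf H}_{n,k}\,\mathbf\Theta_{n+m}(x).$$
   Context: All polynomials are real polynomials in one variable $x$. A polynomial basis means that for every integer $N\ge 0$ we are given a family $\theta_{0,N}(x),\dots,\theta_{N,N}(x)$ which is a basis of the space of real polynomials of degree at most $N$; write $\mathbf\Theta_N(x)=[\theta_{0,N}(x),\dots,\theta_{N,N}(x)]^T$ for the column vector of basis elements. The matrices are constant (independent of $x$). The matrix $\tilde{\mathbf H}_{n,k}$, called the operational matrix, is allowed to depend on $m$ as well as on $n$ and $k$. *)

theory Defs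
  imports "HOL-Computational_Algebra.Polynomial" Jordan_Normal_Form.Matrix
begin

global_interpretation real_poly: vector_space "Polynomial.smult :: real \<Rightarrow> real poly \<Rightarrow> real poly"
  by unfold_locales (simp_all add: smult_add_right smult_add_left)

text \<open>The argument order \<open>\<theta> k N\<close> follows the subscripts. Injectivity is needed because a basis is
  an indexed family here, whereas the library's independence is a property of sets.
  As \<open>degree 0 = 0\<close>, the zero polynomial belongs to the space for every \<open>N\<close>.\<close>

definition polynomial_basis :: "(nat \<Rightarrow> nat \<Rightarrow> real poly) \<Rightarrow> bool" where
  "polynomial_basis \<theta> \<longleftrightarrow>
     (\<forall>N. inj_on (\<lambda>k. \<theta> k N) {0..N}
        \<and> real_poly.independent ((\<lambda>k. \<theta> k N) ` {0..N})
        \<and> real_poly.span ((\<lambda>k. \<theta> k N) ` {0..N}) = {p. degree p \<le> N})"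

definition basis_vector :: "(nat \<Rightarrow> nat \<Rightarrow> real poly) \<Rightarrow> nat \<Rightarrow> real poly vec" where
  "basis_vector \<theta> N = vec (N + 1) (\<lambda>k. \<theta> k N)"

text \<open>A real matrix acts on vectors of polynomials through the embedding of the reals as
  constant polynomials.\<close>

definition const_poly_mat :: "real mat \<Rightarrow> real poly mat" where
  "const_poly_mat A = map_mat (\<lambda>c. [:c:]) A"

end

theory Submission
  imports Defs
begin

text \<open>Row \<open>i\<close> of the matrix equation says that row \<open>i\<close> of
  \<open>H\<close> lists the coordinates of \<open>\<theta> k m * \<theta> i n\<close> in the basis
  of index \<open>n + m\<close>. This product has degree at most \<open>n + m\<close>, so such
  coordinates exist because the basis spans (\<open>polynomial_basis_expansion\<close>), and they
  are unique because it is independent (\<open>polynomial_basis_coeffs_unique\<close>). The rows do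
  not interact, so the whole matrix exists and is unique.\<close>

lemma polynomial_basis_expansion:
  assumes "polynomial_basis \<theta>" and "degree p \<le> N"
  obtains c where "p = (\<Sum>j = 0..N. Polynomial.smult (c j) (\<theta> j N))"
proof -
  let ?f = "\<lambda>j. \<theta> j N"
  have inj: "inj_on ?f {0..N}" and "p \<in> real_poly.span (?f ` {0..N})"
    using assms by (auto simp: polynomial_basis_def)
  then obtain u where "p = (\<Sum>v \<in> ?f ` {0..N}. Polynomial.smult (u v) v)"
    by (auto simp: real_poly.span_finite)
  also have "\<dots> = (\<Sum>j = 0..N. Polynomial.smult (u (\<theta> j N)) (\<theta> j N))"
    using inj by (simp add: sum.reindex)
  finally show thesis by (rule that)
qed

text \<open>The difference of the two expansions is a vanishing linear combination, so independence
  kills every \<open>c j - d j\<close>.\<close>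

lemma polynomial_basis_coeffs_unique:
  assumes "polynomial_basis \<theta>"
    and eq: "(\<Sum>j = 0..N. Polynomial.smult (c j) (\<theta> j N)) = (\<Sum>j = 0..N. Polynomial.smult (d j) (\<theta> j N))"
    and "i \<le> N"
  shows "c i = d i"
proof -
  let ?f = "\<lambda>j. \<theta> j N"
  \<comment> \<open>Independence concerns a set of polynomials, so coefficients must be functions of
    the polynomial; \<open>?g\<close> recovers the index, which injectivity makes well
    defined.\<close>
  let ?g = "the_inv_into {0..N} ?f"
  let ?u = "\<lambda>v. c (?g v) - d (?g v)"
  have inj: "inj_on ?f {0..N}" and indep: "real_poly.independent (?f ` {0..N})"
    using assms(1) by (auto simp: polynomial_basis_def)
  have "(\<Sum>v \<in> ?f ` {0..N}. Polynomial.smult (?u v) v) = (\<Sum>j = 0..N. Polynomial.smult (c j - d j) (\<theta> j N))"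
    using inj by (simp add: sum.reindex the_inv_into_f_f[OF inj])
  also have "\<dots> = 0"
    using eq by (simp add: smult_diff_left sum_subtractf)
  finally have "?u v = 0" if "v \<in> ?f ` {0..N}" for v
    using real_poly.independentD[OF indep _ subset_refl _ that, of ?u] by simp
  from this[of "?f i"] \<open>i \<le> N\<close> show ?thesis
    by (simp add: the_inv_into_f_f[OF inj])
qed

text \<open>Multiplying by the constant polynomial \<open>[:c:]\<close> is scaling by
  \<open>c\<close>, so an entry of the product is a real linear combination of basis
  elements.\<close>

lemma const_poly_mat_mult_basis_vector_index:
  assumes "H \<in> carrier_mat r (N + 1)" and "i < r"
  shows "(const_poly_mat H *\<^sub>v basis_vector \<theta> N) $ i
    = (\<Sum>j = 0..N. Polynomial.smult (H $$ (i, j)) (\<theta> j N))"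
  using assms
  by (auto simp: const_poly_mat_def basis_vector_def scalar_prod_def atLeastLessThanSuc_atLeastAtMost
      intro!: sum.cong)

theorem lemma3p1:
  fixes \<theta> :: "nat \<Rightarrow> nat \<Rightarrow> real poly" and n m k :: nat
  assumes "polynomial_basis \<theta>" and "0 \<le> k" and "k \<le> m"
  shows "\<exists>!H. H \<in> carrier_mat (n + 1) (n + m + 1) \<and>
           \<theta> k m \<cdot>\<^sub>v basis_vector \<theta> n = const_poly_mat H *\<^sub>v basis_vector \<theta> (n + m)"
proof -
  have rowwise: "\<theta> k m \<cdot>\<^sub>v basis_vector \<theta> n = const_poly_mat H *\<^sub>v basis_vector \<theta> (n + m)
      \<longleftrightarrow> (\<forall>i \<le> n. \<theta> k m * \<theta> i n = (\<Sum>j = 0..n + m. Polynomial.smult (H $$ (i, j)) (\<theta> j (n + m))))"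
    if H: "H \<in> carrier_mat (n + 1) (n + m + 1)" for H
  proof -
    have "dim_vec (\<theta> k m \<cdot>\<^sub>v basis_vector \<theta> n) = n + 1"
      "dim_vec (const_poly_mat H *\<^sub>v basis_vector \<theta> (n + m)) = n + 1"
      using H by (auto simp: basis_vector_def const_poly_mat_def)
    moreover have "(\<theta> k m \<cdot>\<^sub>v basis_vector \<theta> n) $ i = \<theta> k m * \<theta> i n" if "i < n + 1" for i
      using that by (simp add: basis_vector_def)
    ultimately show ?thesis
      using const_poly_mat_mult_basis_vector_index[OF H]
      \<comment> \<open>The deleted rules would rewrite the entries before the two index formulas
        could match.\<close>
      by (simp add: vec_eq_iff less_Suc_eq_le del: index_mult_mat_vec index_smult_vec)
  qed
  \<comment> \<open>Each basis element lies in its own span, which is the space of polynomials of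
    degree at most \<open>N\<close>.\<close>
  have deg: "degree (\<theta> i N) \<le> N" if "i \<le> N" for i N
  proof -
    have "\<theta> i N \<in> real_poly.span ((\<lambda>j. \<theta> j N) ` {0..N})"
      using that by (intro real_poly.span_base) auto
    then show ?thesis
      using assms(1) by (auto simp: polynomial_basis_def)
  qed
  have "\<exists>c. \<theta> k m * \<theta> i n = (\<Sum>j = 0..n + m. Polynomial.smult (c j) (\<theta> j (n + m)))" if "i \<le> n" for i
  proof -
    have "degree (\<theta> k m * \<theta> i n) \<le> n + m"
      using degree_mult_le[of "\<theta> k m" "\<theta> i n"] deg[OF that] deg[OF \<open>k \<le> m\<close>] by linarith
    then show ?thesis
      using polynomial_basis_expansion[OF assms(1)] by metis
  qed
  then obtain C where
    C: "\<And>i. i \<le> n \<Longrightarrow> \<theta> k m * \<theta> i n = (\<Sum>j = 0..n + m. Polynomial.smult (C i j) (\<theta> j (n + m)))"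
    by metis
  show ?thesis
  proof (rule ex1I, intro conjI)
    let ?H = "mat (n + 1) (n + m + 1) (\<lambda>(i, j). C i j)"
    show H: "?H \<in> carrier_mat (n + 1) (n + m + 1)"
      by simp
    show "\<theta> k m \<cdot>\<^sub>v basis_vector \<theta> n = const_poly_mat ?H *\<^sub>v basis_vector \<theta> (n + m)"
      unfolding rowwise[OF H] by (simp add: C)
    fix G
    assume G: "G \<in> carrier_mat (n + 1) (n + m + 1) \<and>
      \<theta> k m \<cdot>\<^sub>v basis_vector \<theta> n = const_poly_mat G *\<^sub>v basis_vector \<theta> (n + m)"
    \<comment> \<open>Row \<open>i\<close> of \<open>G\<close> and \<open>C i\<close> are both
      coordinates of \<open>\<theta> k m * \<theta> i n\<close>.\<close>
    have "G $$ (i, j) = C i j" if "i \<le> n" "j \<le> n + m" for i j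
    proof (rule polynomial_basis_coeffs_unique[OF assms(1) _ that(2)])
      show "(\<Sum>l = 0..n + m. Polynomial.smult (G $$ (i, l)) (\<theta> l (n + m)))
        = (\<Sum>l = 0..n + m. Polynomial.smult (C i l) (\<theta> l (n + m)))"
        using iffD1[OF rowwise[OF conjunct1[OF G]] conjunct2[OF G]] C[OF that(1)] that(1) by simp
    qed
    then show "G = ?H"
      using G by (intro eq_matI) auto
  qed
qed

end
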